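(* Let $n\in\mathbb{N}$, let $\mu$ be a finite measure on $\mathcal{T}=[0,1]$, and let $\bar t=(t_0,\ldots,t_{n-1})\in\mathcal{T}^{n}$. A symmetric mixed-consumption Nash equilibrium exists in the $n$-producers consumer game $(\mu;\bar t)$. Furthermore, there exists such an equilibrium for which the strategies can be computed in $O(n^2)$ time.
   Context: Notation: $\mathbb{N}=\{0,1,2,\ldots\}$, $\mathcal{T}=[0,1]$ (with the Borel $\sigma$-algebra), $\mathbb{P}_n=\{0,1,\ldots,n-1\}$. Consumer game $(\mu;\bar t)$. Consumers form a continuum; consumer types $d\in\mathcal{T}$ are distributed according to the finite measure $\mu$. Producer $j\in\mathbb{P}_n$ has level $t_j\in\mathcal{T}$. The strategies available to type $d$ are $S_d=\{j\in\mathbb{P}_n\mid t_j\le d\}\cup\{\lnot\}$, where $\lnot$ is a symbol meaning "not consuming". Put $S=\mathbb{P}_n\cup\{\lnot\}$ and, for nonempty $S'\subseteq S$, $\Delta^{S'}=\{x\in[0,1]^S\mid \sum_{j\in S'}x_j=1,\ x_j=0 \text{ for } j\in S\setminus S'\}$. A mixed-consumption profile is a measurable function $s:\mathcal{T}\to[0,1]^S$ with $s(d)\in\Delta^{S_d}$ for every $d\in\mathcal{T}$; its loads are $\ell^s_j=\int_{\mathcal{T}}s_j\,d\mu$ for $j\in S$. It is a mixed-consumption Nash equilibrium if for every $d\in\mathcal{T}$: (a) $\lnot\in\operatorname{supp}(s(d))$ only if $S_d=\{\lnot\}$; and (b) $\ell^s_k\le\ell^s_j$ for every $k\in\operatorname{supp}(s(d))$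 and every $j\in S_d\setminus\{\lnot\}$. Here $\operatorname{supp}(s(d))=\{k\in S\mid s_k(d)>0\}$. A profile $s$ is symmetric if $S_{d_1}=S_{d_2}$ implies $s(d_1)=s(d_2)$ for all $d_1,d_2\in\mathcal{T}$. Running time counts real arithmetic operations, comparisons, and evaluations of $\mu$ on intervals at unit cost; the input is $\bar t$ (and access to $\mu$), and the output is the common value of $s$ on each class of types $d$ having the same $S_d$. *)

theory Defs
  imports "HOL-Analysis.Analysis" "HOL-Library.Landau_Symbols"
begin

section \<open>The consumer game\<close>

datatype strategy = Producer nat | NotConsuming

abbreviation types :: "real set"
  where "types \<equiv> {0..1}"

text \<open>Only the levels \<open>t 0, \<dots>, t (n - 1)\<close> are meaningful; no notion below depends on the others.\<close>

definition consumer_game :: "nat \<Rightarrow> real measure \<Rightarrow> (nat \<Rightarrow> real) \<Rightarrow> bool"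
  where "consumer_game n \<mu> t \<longleftrightarrow>
    finite_measure \<mu> \<and> sets \<mu> = sets (restrict_space borel types) \<and> (\<forall>j<n. t j \<in> types)"

definition strategies :: "nat \<Rightarrow> strategy set"
  where "strategies n = Producer ` {..<n} \<union> {NotConsuming}"

definition available :: "nat \<Rightarrow> (nat \<Rightarrow> real) \<Rightarrow> real \<Rightarrow> strategy set"
  where "available n t d = Producer ` {j. j < n \<and> t j \<le> d} \<union> {NotConsuming}"

definition mixed_strategies :: "nat \<Rightarrow> strategy set \<Rightarrow> (strategy \<Rightarrow> real) set"
  where "mixed_strategies n S' =
    {x \<in> strategies n \<rightarrow>\<^sub>E {0..1}. (\<Sum>j\<in>S'. x j) = 1 \<and> (\<forall>j\<in>strategies n - S'. x j = 0)}"

definition mixed_profile ::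
    "nat \<Rightarrow> real measure \<Rightarrow> (nat \<Rightarrow> real) \<Rightarrow> (real \<Rightarrow> strategy \<Rightarrow> real) \<Rightarrow> bool"
  where "mixed_profile n \<mu> t s \<longleftrightarrow>
    s \<in> measurable (restrict_space borel types)
          (\<Pi>\<^sub>M j\<in>strategies n. restrict_space borel {0..1}) \<and>
    (\<forall>d\<in>types. s d \<in> mixed_strategies n (available n t d))"

definition load :: "real measure \<Rightarrow> (real \<Rightarrow> strategy \<Rightarrow> real) \<Rightarrow> strategy \<Rightarrow> real"
  where "load \<mu> s j = (LINT d|\<mu>. s d j)"

definition supp :: "nat \<Rightarrow> (strategy \<Rightarrow> real) \<Rightarrow> strategy set"
  where "supp n x = {k \<in> strategies n. x k > 0}"

definition mixed_Nash_equilibrium ::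
    "nat \<Rightarrow> real measure \<Rightarrow> (nat \<Rightarrow> real) \<Rightarrow> (real \<Rightarrow> strategy \<Rightarrow> real) \<Rightarrow> bool"
  where "mixed_Nash_equilibrium n \<mu> t s \<longleftrightarrow> mixed_profile n \<mu> t s \<and>
    (\<forall>d\<in>types.
      (NotConsuming \<in> supp n (s d) \<longrightarrow> available n t d = {NotConsuming}) \<and>
      (\<forall>k\<in>supp n (s d). \<forall>j\<in>available n t d - {NotConsuming}. load \<mu> s k \<le> load \<mu> s j))"

definition symmetric_profile ::
    "nat \<Rightarrow> (nat \<Rightarrow> real) \<Rightarrow> (real \<Rightarrow> strategy \<Rightarrow> real) \<Rightarrow> bool"
  where "symmetric_profile n t s \<longleftrightarrow>
    (\<forall>d1\<in>types. \<forall>d2\<in>types. available n t d1 = available n t d2 \<longrightarrow> s d1 = s d2)"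


section \<open>A real RAM with an oracle for the measure of intervals\<close>

text \<open>
  Programs are written in a small while language over a memory consisting of named one-dimensional
  arrays of natural numbers (used for indices and control) and named two-dimensional arrays of
  real numbers; scalars are cells with index 0. Index arithmetic is restricted to addition
  and (truncated) subtraction, so that no computational power is hidden in large integers.
  There is no rounding and no conversion from reals to indices. Division by zero yields zero, as
  usual in HOL.
\<close>

record memory =
  idx :: "string \<Rightarrow> nat \<Rightarrow> nat"
  rls :: "string \<Rightarrow> nat \<Rightarrow> nat \<Rightarrow> real"

datatype iexp =
    INum nat
  | ICell string iexp
  | IAdd iexp iexp
  | ISub iexp iexp

datatype rexp =
    RNum nat
  | RCell string iexp iexp
  | RAdd rexp rexp
  | RSub rexp rexp
  | RMul rexp rexp
  | RDiv rexp rexp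
  | RMeasure bool bool rexp rexp

datatype bexp =
    BILess iexp iexp
  | BRLess rexp rexp
  | BNot bexp
  | BAnd bexp bexp

datatype com =
    Skip
  | IAssign string iexp iexp
  | RAssign string iexp iexp rexp
  | Seq com com
  | Cond bexp com com
  | Loop bexp com

text \<open>The two flags state whether the left and the right endpoint belong to the interval.\<close>

definition interval_of :: "bool \<Rightarrow> bool \<Rightarrow> real \<Rightarrow> real \<Rightarrow> real set"
  where "interval_of lc rc a b =
    {x. (if lc then a \<le> x else a < x) \<and> (if rc then x \<le> b else x < b)}"

primrec ival :: "memory \<Rightarrow> iexp \<Rightarrow> nat" where
  "ival \<sigma> (INum k) = k"
| "ival \<sigma> (ICell x e) = idx \<sigma> x (ival \<sigma> e)"
| "ival \<sigma> (IAdd e1 e2) = ival \<sigma> e1 + ival \<sigma> e2"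
| "ival \<sigma> (ISub e1 e2) = ival \<sigma> e1 - ival \<sigma> e2"

primrec rval :: "real measure \<Rightarrow> memory \<Rightarrow> rexp \<Rightarrow> real" where
  "rval \<mu> \<sigma> (RNum k) = real k"
| "rval \<mu> \<sigma> (RCell x e1 e2) = rls \<sigma> x (ival \<sigma> e1) (ival \<sigma> e2)"
| "rval \<mu> \<sigma> (RAdd e1 e2) = rval \<mu> \<sigma> e1 + rval \<mu> \<sigma> e2"
| "rval \<mu> \<sigma> (RSub e1 e2) = rval \<mu> \<sigma> e1 - rval \<mu> \<sigma> e2"
| "rval \<mu> \<sigma> (RMul e1 e2) = rval \<mu> \<sigma> e1 * rval \<mu> \<sigma> e2"
| "rval \<mu> \<sigma> (RDiv e1 e2) = rval \<mu> \<sigma> e1 / rval \<mu> \<sigma> e2"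
| "rval \<mu> \<sigma> (RMeasure lc rc e1 e2) =
     measure \<mu> (interval_of lc rc (rval \<mu> \<sigma> e1) (rval \<mu> \<sigma> e2) \<inter> types)"

primrec bval :: "real measure \<Rightarrow> memory \<Rightarrow> bexp \<Rightarrow> bool" where
  "bval \<mu> \<sigma> (BILess e1 e2) \<longleftrightarrow> ival \<sigma> e1 < ival \<sigma> e2"
| "bval \<mu> \<sigma> (BRLess e1 e2) \<longleftrightarrow> rval \<mu> \<sigma> e1 < rval \<mu> \<sigma> e2"
| "bval \<mu> \<sigma> (BNot b) \<longleftrightarrow> \<not> bval \<mu> \<sigma> b"
| "bval \<mu> \<sigma> (BAnd b1 b2) \<longleftrightarrow> bval \<mu> \<sigma> b1 \<and> bval \<mu> \<sigma> b2"

text \<open>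
  Every node of an expression and every elementary control step costs one unit. Besides real
  arithmetic, comparisons and evaluations of the measure, this also charges for constants, memory
  accesses, index arithmetic and branching, so a time bound here is in particular a bound on the
  number of real operations, comparisons and measure evaluations.
\<close>

primrec itime :: "iexp \<Rightarrow> nat" where
  "itime (INum k) = 1"
| "itime (ICell x e) = itime e + 1"
| "itime (IAdd e1 e2) = itime e1 + itime e2 + 1"
| "itime (ISub e1 e2) = itime e1 + itime e2 + 1"

primrec rtime :: "rexp \<Rightarrow> nat" where
  "rtime (RNum k) = 1"
| "rtime (RCell x e1 e2) = itime e1 + itime e2 + 1"
| "rtime (RAdd e1 e2) = rtime e1 + rtime e2 + 1"
| "rtime (RSub e1 e2) = rtime e1 + rtime e2 + 1"
| "rtime (RMul e1 e2) = rtime e1 + rtime e2 + 1"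
| "rtime (RDiv e1 e2) = rtime e1 + rtime e2 + 1"
| "rtime (RMeasure lc rc e1 e2) = rtime e1 + rtime e2 + 1"

primrec btime :: "bexp \<Rightarrow> nat" where
  "btime (BILess e1 e2) = itime e1 + itime e2 + 1"
| "btime (BRLess e1 e2) = rtime e1 + rtime e2 + 1"
| "btime (BNot b) = btime b + 1"
| "btime (BAnd b1 b2) = btime b1 + btime b2 + 1"

definition iupdate :: "string \<Rightarrow> nat \<Rightarrow> nat \<Rightarrow> memory \<Rightarrow> memory"
  where "iupdate x i v \<sigma> = \<sigma>\<lparr>idx := (idx \<sigma>)(x := (idx \<sigma> x)(i := v))\<rparr>"

definition rupdate :: "string \<Rightarrow> nat \<Rightarrow> nat \<Rightarrow> real \<Rightarrow> memory \<Rightarrow> memory"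
  where "rupdate x i j v \<sigma> =
    \<sigma>\<lparr>rls := (rls \<sigma>)(x := (rls \<sigma> x)(i := (rls \<sigma> x i)(j := v)))\<rparr>"

text \<open>\<open>runs \<mu> c \<sigma> k \<sigma>'\<close>: started in memory \<open>\<sigma>\<close>, the program \<open>c\<close> halts in memory \<open>\<sigma>'\<close> after
  exactly \<open>k\<close> time units.\<close>

inductive runs :: "real measure \<Rightarrow> com \<Rightarrow> memory \<Rightarrow> nat \<Rightarrow> memory \<Rightarrow> bool"
  for \<mu> :: "real measure"
where
  Skip: "runs \<mu> Skip \<sigma> 1 \<sigma>"
| IAssign: "runs \<mu> (IAssign x e1 e2) \<sigma> (itime e1 + itime e2 + 1)
    (iupdate x (ival \<sigma> e1) (ival \<sigma> e2) \<sigma>)"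
| RAssign: "runs \<mu> (RAssign x e1 e2 e) \<sigma> (itime e1 + itime e2 + rtime e + 1)
    (rupdate x (ival \<sigma> e1) (ival \<sigma> e2) (rval \<mu> \<sigma> e) \<sigma>)"
| Seq: "runs \<mu> c1 \<sigma> k1 \<sigma>' \<Longrightarrow> runs \<mu> c2 \<sigma>' k2 \<sigma>'' \<Longrightarrow> runs \<mu> (Seq c1 c2) \<sigma> (k1 + k2) \<sigma>''"
| CondTrue: "bval \<mu> \<sigma> b \<Longrightarrow> runs \<mu> c1 \<sigma> k \<sigma>' \<Longrightarrow> runs \<mu> (Cond b c1 c2) \<sigma> (btime b + 1 + k) \<sigma>'"
| CondFalse: "\<not> bval \<mu> \<sigma> b \<Longrightarrow> runs \<mu> c2 \<sigma> k \<sigma>' \<Longrightarrow> runs \<mu> (Cond b c1 c2) \<sigma> (btime b + 1 + k) \<sigma>'"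
| LoopFalse: "\<not> bval \<mu> \<sigma> b \<Longrightarrow> runs \<mu> (Loop b c) \<sigma> (btime b + 1) \<sigma>"
| LoopTrue: "bval \<mu> \<sigma> b \<Longrightarrow> runs \<mu> c \<sigma> k1 \<sigma>' \<Longrightarrow> runs \<mu> (Loop b c) \<sigma>' k2 \<sigma>'' \<Longrightarrow>
    runs \<mu> (Loop b c) \<sigma> (btime b + 1 + k1 + k2) \<sigma>''"


section \<open>Computing a symmetric profile\<close>

definition input_memory :: "nat \<Rightarrow> (nat \<Rightarrow> real) \<Rightarrow> memory"
  where "input_memory n t =
    \<lparr>idx = (\<lambda>x i. if x = ''n'' \<and> i = 0 then n else 0),
     rls = (\<lambda>x i j. if x = ''t'' \<and> i < n \<and> j = 0 then t i else 0)\<rparr>"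

fun column :: "nat \<Rightarrow> strategy \<Rightarrow> nat" where
  "column n (Producer j) = j"
| "column n NotConsuming = n"

text \<open>
  The output is the array \<open>s\<close>. Its row \<open>k < n\<close> holds the common mixed strategy of the class of the
  type \<open>t k\<close>, and its row \<open>n\<close> that of the class of types below all levels (unconstrained if there
  are no such types). These rows cover all classes: if a type \<open>d\<close> has some producer available, then
  it belongs to the class of the largest \<open>t k \<le> d\<close>.
\<close>

definition output_represents ::
    "nat \<Rightarrow> (nat \<Rightarrow> real) \<Rightarrow> memory \<Rightarrow> (real \<Rightarrow> strategy \<Rightarrow> real) \<Rightarrow> bool"
  where "output_represents n t \<sigma> s \<longleftrightarrow>
    (\<forall>d\<in>types. \<forall>j\<in>strategies n.
      (\<forall>k<n. available n t d = available n t (t k) \<longrightarrow> rls \<sigma> ''s'' k (column n j) = s d j) \<and>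
      (available n t d = {NotConsuming} \<longrightarrow> rls \<sigma> ''s'' n (column n j) = s d j))"

end

theory Submission
  imports Defs "HOL-Real_Asymp.Real_Asymp"
begin

text \<open>
  Order the producers by level, breaking ties by index. A type that reaches \<open>i + 1\<close> producers can
  use exactly the first \<open>i + 1\<close>, so the equilibrium loads are the slopes of the least concave
  majorant of the cumulative masses of the classes. Cut the interval from \<open>0\<close> to the total mass once
  at the cumulative masses of the classes and once at the values of the majorant; the class \<open>i\<close> gives
  producer \<open>p\<close> the length of the intersection of the \<open>i\<close>-th piece of the first partition with
  the \<open>p\<close>-th piece of the second, divided by the mass of the class. The majorant lies above the
  cumulative masses, so only producers within reach are used; wherever its slope strictly
  decreases it touches them, so the pieces to the left of such a point do not meet the classes to
  the right of it, and only producers of minimal load are used.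

  Each slope is the largest slope of a chord from the current point of the majorant to a later
  cumulative mass, so all slopes are found with quadratically many comparisons.
\<close>

subsection \<open>The concave majorant and the partition of the mass\<close>

text \<open>The inserted \<open>0\<close> gives the maximum a value at \<open>a = n\<close>. For
  \<open>a < n\<close>, \<open>0 \<le> x\<close> and \<open>A n = 0\<close> the maximum is
  unaffected by it, as the chord to \<open>n\<close> has nonnegative slope.\<close>

definition rate :: "(nat \<Rightarrow> real) \<Rightarrow> nat \<Rightarrow> nat \<Rightarrow> real \<Rightarrow> real"
  where "rate A n a x = Max (insert 0 ((\<lambda>b. (x - A b) / real (b - a)) ` {Suc a..n}))"

text \<open>\<open>A 0 - residual A n a\<close> is the least concave majorant of the cumulative masses
  \<open>A 0 - A b\<close>, evaluated at \<open>a\<close>; \<open>rate\<close> is its slope.\<close>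

primrec residual :: "(nat \<Rightarrow> real) \<Rightarrow> nat \<Rightarrow> nat \<Rightarrow> real" where
  "residual A n 0 = A 0"
| "residual A n (Suc a) = residual A n a - rate A n a (residual A n a)"

text \<open>Both partitions are measured from the right end: class \<open>i\<close> is the interval
  from \<open>A (Suc i)\<close> to \<open>A i\<close>, and producer \<open>p\<close> has the
  interval from \<open>residual A n (Suc p)\<close> to \<open>residual A n p\<close>.\<close>

definition overlap :: "(nat \<Rightarrow> real) \<Rightarrow> nat \<Rightarrow> nat \<Rightarrow> nat \<Rightarrow> real"
  where "overlap A n i p =
    max 0 (min (A i) (residual A n p) - max (A (Suc i)) (residual A n (Suc p)))"

text \<open>A class without mass does not influence any load; it may use the last producer within its
  reach, whose load is minimal.\<close>

definition share :: "(nat \<Rightarrow> real) \<Rightarrow> nat \<Rightarrow> nat \<Rightarrow> nat \<Rightarrow> real"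
  where "share A n i p =
    (if A (Suc i) < A i then overlap A n i p / (A i - A (Suc i)) else of_bool (p = i))"

lemma rate_nonneg: "0 \<le> rate A n a x"
  by (simp add: rate_def)

lemma rate_ge: "a < b \<Longrightarrow> b \<le> n \<Longrightarrow> (x - A b) / real (b - a) \<le> rate A n a x"
  unfolding rate_def by (rule Max_ge) auto

lemma rate_attained:
  assumes "0 < rate A n a x"
  obtains b where "a < b" "b \<le> n" "rate A n a x = (x - A b) / real (b - a)"
proof -
  have "rate A n a x \<in> insert 0 ((\<lambda>b. (x - A b) / real (b - a)) ` {Suc a..n})"
    unfolding rate_def by (rule Max_in) auto
  then show thesis
  proof (elim insertE imageE)
    fix b assume "rate A n a x = (x - A b) / real (b - a)" "b \<in> {Suc a..n}"
    then show thesis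
      using that[of b] by simp
  qed (use assms in simp)
qed

lemma rate_le:
  assumes "0 \<le> y" "\<And>b. a < b \<Longrightarrow> b \<le> n \<Longrightarrow> x - A b \<le> y * real (b - a)"
  shows "rate A n a x \<le> y"
  using assms by (auto simp: rate_def divide_le_eq)

text \<open>The length of an intersection is the distance between the ends of one interval clamped
  to the other. In this form sums over a partition telescope.\<close>

lemma max_min_diff:
  fixes a b x y :: real
  assumes "b \<le> a" "y \<le> x"
  shows "max 0 (min a x - max b y) = max b (min a x) - max b (min a y)"
  using assms by (auto simp: max_def min_def)

lemma sum_consecutive_diff:
  fixes f :: "nat \<Rightarrow> real"
  shows "(\<Sum>p<m. f p - f (Suc p)) = f 0 - f m"
  by (induction m) auto

locale masses =
  fixes A :: "nat \<Rightarrow> real" and n :: nat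
  assumes antimono_A: "antimono A" and A_n: "A n = 0"
begin

abbreviation "D \<equiv> residual A n"

lemma A_le: "i \<le> j \<Longrightarrow> A j \<le> A i"
  using antimono_A by (auto simp: antimono_def)

lemma A_nonneg: "i \<le> n \<Longrightarrow> 0 \<le> A i"
  using A_le A_n by metis

lemma antimono_D: "antimono D"
  by (simp add: antimono_iff_le_Suc rate_nonneg)

lemma D_le: "i \<le> j \<Longrightarrow> D j \<le> D i"
  using antimono_D by (auto simp: antimono_def)

text \<open>One step along a chord of width at least \<open>1\<close> that ends at some
  \<open>A b \<ge> 0\<close> cannot lose more than the current value.\<close>

lemma D_nonneg: "a \<le> n \<Longrightarrow> 0 \<le> D a"
proof (induction a)
  case 0
  then show ?case using A_nonneg by simp
next
  case (Suc a)
  show ?case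
  proof (cases "rate A n a (D a) = 0")
    case True
    with Suc show ?thesis by simp
  next
    case False
    with rate_nonneg have "0 < rate A n a (D a)" by (metis order_le_less)
    then obtain b where b: "a < b" "b \<le> n" "rate A n a (D a) = (D a - A b) / real (b - a)"
      by (rule rate_attained)
    have D: "0 \<le> D a"
      using Suc by simp
    have "(D a - A b) / real (b - a) \<le> D a / real (b - a)"
      using A_nonneg[OF b(2)] by (intro divide_right_mono) auto
    also have "\<dots> \<le> D a / 1"
      using b(1) D by (intro divide_left_mono) auto
    finally show ?thesis
      using b(3) by simp
  qed
qed

text \<open>The chord to the next index competes in \<open>rate\<close>. This says that the majorant
  lies above the cumulative masses.\<close>

lemma D_le_A: "a \<le> n \<Longrightarrow> D a \<le> A a"
proof (cases a)
  case (Suc a')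
  then show "a \<le> n \<Longrightarrow> D a \<le> A a"
    using rate_ge[of a' a n "D a'" A] by simp
qed simp

text \<open>Concavity: every target seen from \<open>a\<close> obeys the bound given by the maximal
  slope, and moving one step along that slope preserves the bound.\<close>

lemma rate_Suc_le: "rate A n (Suc a) (D (Suc a)) \<le> rate A n a (D a)"
proof (rule rate_le)
  fix b assume b: "Suc a < b" "b \<le> n"
  then have "D a - A b \<le> rate A n a (D a) * real (b - a)"
    using rate_ge[of a b n "D a" A] by (simp add: divide_le_eq)
  moreover have "real (b - a) = real (b - Suc a) + 1"
    using b by (simp add: of_nat_diff)
  ultimately show "D (Suc a) - A b \<le> rate A n a (D a) * real (b - Suc a)"
    by (simp add: algebra_simps)
qed (rule rate_nonneg)

lemma rate_antimono: "a \<le> b \<Longrightarrow> rate A n b (D b) \<le> rate A n a (D a)"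
  by (induction rule: dec_induct) (use rate_Suc_le order_trans in blast)+

text \<open>The steepest chord from \<open>a\<close> then ends at \<open>Suc a\<close>: a longer one would still be available
  from \<open>Suc a\<close>.\<close>
lemma D_Suc_eq:
  assumes "rate A n (Suc a) (D (Suc a)) < rate A n a (D a)"
  shows "D (Suc a) = A (Suc a)"
proof -
  have "0 < rate A n a (D a)"
    using assms rate_nonneg[of A n "Suc a" "D (Suc a)"] by linarith
  then obtain b where b: "a < b" "b \<le> n" "rate A n a (D a) = (D a - A b) / real (b - a)"
    by (rule rate_attained)
  have eq: "D a - A b = rate A n a (D a) * real (b - a)"
    using b by simp
  have "b = Suc a"
  proof (rule ccontr)
    assume "b \<noteq> Suc a"
    with b have "Suc a < b" by simp
    moreover have "real (b - a) = real (b - Suc a) + 1"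
      using b by (simp add: of_nat_diff)
    ultimately have "rate A n a (D a) = (D (Suc a) - A b) / real (b - Suc a)"
      using eq by (simp add: field_simps)
    then show False
      using rate_ge[of "Suc a" b n "D (Suc a)" A] \<open>Suc a < b\<close> b(2) assms by simp
  qed
  with b show ?thesis by simp
qed

text \<open>A strict decrease over a range happens at some single step of it, where
  \<open>D_Suc_eq\<close> applies.\<close>

lemma D_touches_A:
  assumes "rate A n b (D b) < rate A n a (D a)" "a \<le> b"
  obtains c where "a \<le> c" "c < b" "D (Suc c) = A (Suc c)"
proof -
  have "\<exists>c. a \<le> c \<and> c < b \<and> D (Suc c) = A (Suc c)"
    using assms(2,1)
  proof (induction rule: dec_induct)
    case (step b)
    then show ?case
      using D_Suc_eq[of b] by (cases "rate A n b (D b) < rate A n a (D a)")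
        (fastforce, metis dual_order.strict_trans1 less_Suc_eq linorder_not_less)
  qed simp
  with that show thesis by blast
qed

section \<open>Intersecting the two partitions\<close>

lemma overlap_row: "overlap A n i p =
    max (A (Suc i)) (min (A i) (D p)) - max (A (Suc i)) (min (A i) (D (Suc p)))"
  unfolding overlap_def by (rule max_min_diff) (auto intro: A_le D_le simp del: residual.simps)

text \<open>Intersection is symmetric, so the ends of the class can be clamped instead; sums over
  classes then telescope.\<close>

lemma overlap_column: "overlap A n i p =
    max (D (Suc p)) (min (D p) (A i)) - max (D (Suc p)) (min (D p) (A (Suc i)))"
  unfolding overlap_def
  using max_min_diff[of "D (Suc p)" "D p" "A (Suc i)" "A i"] A_le[of i "Suc i"] D_le[of p "Suc p"]
  by (simp add: max.commute min.commute del: residual.simps)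

text \<open>The pieces of the producers up to \<open>i\<close> fill the interval from
  \<open>D (Suc i)\<close> to \<open>D 0 = A 0\<close>, which contains class \<open>i\<close>
  because \<open>D (Suc i) \<le> A (Suc i)\<close>.\<close>

lemma sum_overlap_row:
  assumes "i < n"
  shows "(\<Sum>p<Suc i. overlap A n i p) = A i - A (Suc i)"
proof -
  have "D (Suc i) \<le> A (Suc i)" "A i \<le> D 0" "A (Suc i) \<le> A i"
    using D_le_A[of "Suc i"] A_le[of 0 i] A_le[of i "Suc i"] assms by auto
  then show ?thesis
    unfolding overlap_row sum_consecutive_diff[of "\<lambda>p. max (A (Suc i)) (min (A i) (D p))"]
    by (simp add: max_def min_def del: residual.simps)
qed

text \<open>The classes fill the interval from \<open>A n = 0\<close> to \<open>A 0\<close>, which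
  contains the piece of \<open>p\<close>; the length of that piece is the slope.\<close>

lemma sum_overlap_column:
  assumes "p < n"
  shows "(\<Sum>i<n. overlap A n i p) = rate A n p (D p)"
proof -
  have "D p \<le> A 0" "A n \<le> D (Suc p)" "D (Suc p) \<le> D p"
    using D_le[of 0 p] D_nonneg[of "Suc p"] A_n D_le[of p "Suc p"] assms
    by (auto simp del: residual.simps(2))
  then have "(\<Sum>i<n. overlap A n i p) = D p - D (Suc p)"
    unfolding overlap_column sum_consecutive_diff[of "\<lambda>i. max (D (Suc p)) (min (D p) (A i))"]
    by (auto simp add: max_def min_def simp del: residual.simps)
  then show ?thesis by simp
qed

text \<open>The drop yields a contact point \<open>Suc c\<close>: the piece of \<open>p\<close> lies
  above the common value \<open>A (Suc c) = D (Suc c)\<close>, class \<open>i\<close> below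
  it.\<close>

lemma overlap_eq_0:
  assumes "p \<le> i" "i < n" "rate A n i (D i) < rate A n p (D p)"
  shows "overlap A n i p = 0"
proof -
  obtain c where c: "p \<le> c" "c < i" "D (Suc c) = A (Suc c)"
    using D_touches_A[OF assms(3,1)] by metis
  then have "A i \<le> D (Suc p)"
    using A_le[of "Suc c" i] D_le[of "Suc p" "Suc c"] by (simp del: residual.simps)
  then show ?thesis
    by (auto simp: overlap_def max_def min_def simp del: residual.simps)
qed

section \<open>Normalising the overlaps to mixed strategies\<close>

lemma overlap_nonneg: "0 \<le> overlap A n i p"
  by (simp add: overlap_def)

lemma share_nonneg: "0 \<le> share A n i p"
  by (simp add: share_def overlap_nonneg)

lemma sum_share:
  assumes "i < n"
  shows "(\<Sum>p<Suc i. share A n i p) = 1"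
proof (cases "A (Suc i) < A i")
  case True
  then show ?thesis
    unfolding share_def using sum_overlap_row[OF assms]
    by (simp add: sum_divide_distrib[symmetric] del: sum.lessThan_Suc)
next
  case False
  then show ?thesis by (simp add: share_def)
qed

text \<open>Out of reach, \<open>D p \<le> D (Suc i) \<le> A (Suc i)\<close>, so the piece of
  \<open>p\<close> lies below class \<open>i\<close>.\<close>

lemma share_eq_0:
  assumes "i < p" "p \<le> n"
  shows "share A n i p = 0"
proof -
  have "D p \<le> A (Suc i)"
    using D_le[of "Suc i" p] D_le_A[of "Suc i"] assms by (simp del: residual.simps)
  then show ?thesis
    using assms by (auto simp: share_def overlap_def max_def min_def simp del: residual.simps)
qed

lemma share_le_1:
  assumes "i < n" "p \<le> n"
  shows "share A n i p \<le> 1"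
proof (cases "p < Suc i")
  case True
  then have "share A n i p \<le> (\<Sum>p<Suc i. share A n i p)"
    by (intro member_le_sum share_nonneg) auto
  with sum_share[OF assms(1)] show ?thesis by simp
qed (use assms share_eq_0 in auto)

text \<open>A positive share excludes a drop of the slope between \<open>p\<close> and
  \<open>i\<close>, and by concavity the slope at \<open>i\<close> is the least within
  reach.\<close>

lemma rate_minimal_if_share_pos:
  assumes "0 < share A n i p" "i < n" "p \<le> n" "q \<le> i"
  shows "rate A n p (D p) \<le> rate A n q (D q)"
proof -
  have p: "p \<le> i"
    using assms share_eq_0 by (metis leI less_irrefl)
  have "rate A n p (D p) \<le> rate A n i (D i)"
  proof (rule ccontr)
    assume "\<not> ?thesis"
    \<comment> \<open>\<open>p \<noteq> i\<close> rules out the default share of a class without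
      mass.\<close>
    then have "overlap A n i p = 0" "p \<noteq> i"
      using overlap_eq_0[OF p assms(2)] by auto
    with assms(1) show False
      by (auto simp: share_def split: if_splits)
  qed
  also have "\<dots> \<le> rate A n q (D q)"
    using assms(4) by (rule rate_antimono)
  finally show ?thesis .
qed

text \<open>A class without mass is a degenerate interval, so both sides vanish whatever its default
  share is.\<close>

lemma share_times_mass: "share A n i p * (A i - A (Suc i)) = overlap A n i p"
proof (cases "A (Suc i) < A i")
  case False
  then have "A (Suc i) = A i"
    using A_le[of i "Suc i"] by simp
  then show ?thesis
    by (auto simp: overlap_def)
qed (simp add: share_def)

end

subsection \<open>The equilibrium\<close>

definition reach :: "nat \<Rightarrow> (nat \<Rightarrow> real) \<Rightarrow> real \<Rightarrow> nat"
  where "reach n t d = card {j. j < n \<and> t j \<le> d}"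

definition precedes :: "(nat \<Rightarrow> real) \<Rightarrow> nat \<Rightarrow> nat \<Rightarrow> bool"
  where "precedes t j k \<longleftrightarrow> t j < t k \<or> t j = t k \<and> j < k"

definition level_rank :: "nat \<Rightarrow> (nat \<Rightarrow> real) \<Rightarrow> nat \<Rightarrow> nat"
  where "level_rank n t k = card {j. j < n \<and> precedes t j k}"

text \<open>Class \<open>i\<close> consists of the types with \<open>reach\<close> equal to
  \<open>Suc i\<close>; types that reach no producer enter none of these masses.\<close>

definition tail_mass :: "nat \<Rightarrow> real measure \<Rightarrow> (nat \<Rightarrow> real) \<Rightarrow> nat \<Rightarrow> real"
  where "tail_mass n \<mu> t i = measure \<mu> {d\<in>types. i < reach n t d}"

text \<open>The argument \<open>c\<close> is a value of \<open>reach\<close>, hence the shift to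
  class \<open>c - 1\<close>. The restriction supplies the extensionality demanded by
  \<open>mixed_strategies\<close>.\<close>

definition class_strategy :: "nat \<Rightarrow> real measure \<Rightarrow> (nat \<Rightarrow> real) \<Rightarrow> nat \<Rightarrow> strategy \<Rightarrow> real"
  where "class_strategy n \<mu> t c = restrict
    (\<lambda>k. case k of
        Producer j \<Rightarrow> if c = 0 then 0 else share (tail_mass n \<mu> t) n (c - 1) (level_rank n t j)
      | NotConsuming \<Rightarrow> of_bool (c = 0))
    (strategies n)"

definition chord_profile :: "nat \<Rightarrow> real measure \<Rightarrow> (nat \<Rightarrow> real) \<Rightarrow> real \<Rightarrow> strategy \<Rightarrow> real"
  where "chord_profile n \<mu> t d = class_strategy n \<mu> t (reach n t d)"

section \<open>Ranks of producers and classes of types\<close>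

lemma reach_le: "reach n t d \<le> n"
  unfolding reach_def by (rule order_trans[OF card_mono[of "{..<n}"]]) auto

lemma level_rank_less:
  assumes "j < n"
  shows "level_rank n t j < n"
proof -
  have "level_rank n t j < card {..<n}"
    unfolding level_rank_def using assms by (intro psubset_card_mono) (auto simp: precedes_def)
  then show ?thesis by simp
qed

lemma level_rank_mono:
  assumes "precedes t j k" "j < n"
  shows "level_rank n t j < level_rank n t k"
  unfolding level_rank_def using assms by (intro psubset_card_mono) (auto simp: precedes_def)

lemma inj_on_level_rank: "inj_on (level_rank n t) {..<n}"
proof (rule inj_onI, rule ccontr)
  fix j k assume jk: "j \<in> {..<n}" "k \<in> {..<n}" "level_rank n t j = level_rank n t k" "j \<noteq> k"
  then have "precedes t j k \<or> precedes t k j"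
    by (auto simp: precedes_def)
  with jk level_rank_mono[of t j k n] level_rank_mono[of t k j n] show False by auto
qed

lemma bij_betw_level_rank: "bij_betw (level_rank n t) {..<n} {..<n}"
proof -
  have "level_rank n t ` {..<n} \<subseteq> {..<n}"
    using level_rank_less by auto
  then show ?thesis
    unfolding bij_betw_def using inj_on_level_rank endo_inj_surj by blast
qed

text \<open>If \<open>t j \<le> d\<close>, then \<open>j\<close> and all its predecessors are within
  reach; otherwise every producer within reach precedes \<open>j\<close>. Availability thus becomes
  an initial segment of the ranks.\<close>

lemma level_rank_less_reach_iff:
  assumes "j < n"
  shows "level_rank n t j < reach n t d \<longleftrightarrow> t j \<le> d"
proof
  assume "t j \<le> d"
  with assms show "level_rank n t j < reach n t d"
    unfolding level_rank_def reach_def by (intro psubset_card_mono) (auto simp: precedes_def)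
next
  assume "level_rank n t j < reach n t d"
  show "t j \<le> d"
  proof (rule ccontr)
    assume "\<not> t j \<le> d"
    then have "reach n t d \<le> level_rank n t j"
      unfolding level_rank_def reach_def by (intro card_mono) (auto simp: precedes_def)
    with \<open>level_rank n t j < reach n t d\<close> show False by simp
  qed
qed

lemma level_rank_image_available: "level_rank n t ` {j. j < n \<and> t j \<le> d} = {..<reach n t d}"
proof (intro set_eqI iffI)
  fix p assume p: "p \<in> {..<reach n t d}"
  then have "p \<in> level_rank n t ` {..<n}"
    using bij_betw_level_rank[of n t] reach_le[of n t d] by (auto simp: bij_betw_def)
  with p show "p \<in> level_rank n t ` {j. j < n \<and> t j \<le> d}"
    using level_rank_less_reach_iff by auto
qed (auto simp: level_rank_less_reach_iff)

lemma Producer_mem_available: "Producer j \<in> available n t d \<longleftrightarrow> j < n \<and> t j \<le> d"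
  by (auto simp: available_def)

lemma reach_cong: "available n t d1 = available n t d2 \<Longrightarrow> reach n t d1 = reach n t d2"
  unfolding reach_def Producer_mem_available[symmetric] by simp

lemma reach_eq_0_iff: "reach n t d = 0 \<longleftrightarrow> available n t d = {NotConsuming}"
  unfolding reach_def available_def by auto

lemma class_strategy_NotConsuming: "class_strategy n \<mu> t c NotConsuming = of_bool (c = 0)"
  by (simp add: class_strategy_def strategies_def)

lemma class_strategy_Producer:
  "j < n \<Longrightarrow> class_strategy n \<mu> t c (Producer j) =
    (if c = 0 then 0 else share (tail_mass n \<mu> t) n (c - 1) (level_rank n t j))"
  by (simp add: class_strategy_def strategies_def)

section \<open>The game and its equilibrium\<close>

locale game =
  fixes n :: nat and \<mu> :: "real measure" and t :: "nat \<Rightarrow> real"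
  assumes consumer_game: "consumer_game n \<mu> t"
begin

sublocale finite_measure \<mu>
  using consumer_game by (simp add: consumer_game_def)

lemma sets_\<mu>: "sets \<mu> = sets (restrict_space borel types)"
  using consumer_game by (simp add: consumer_game_def)

lemma space_\<mu>: "space \<mu> = types"
  using sets_eq_imp_space_eq[OF sets_\<mu>] by (simp add: space_restrict_space)

lemma measurable_reach_types: "reach n t \<in> measurable (restrict_space borel types) (count_space UNIV)"
  unfolding reach_def
proof (rule measurable_card)
  fix i
  have [measurable]: "(\<lambda>d. d) \<in> borel_measurable (restrict_space borel types)"
    by (rule measurable_restrict_space1) simp
  show "{d \<in> space (restrict_space borel types). i \<in> {j. j < n \<and> t j \<le> d}}
      \<in> sets (restrict_space borel types)"
    unfolding mem_Collect_eq by measurable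
qed

lemma measurable_reach [measurable]: "reach n t \<in> measurable \<mu> (count_space UNIV)"
  using measurable_reach_types unfolding measurable_cong_sets[OF sets_\<mu> refl] .

abbreviation "A \<equiv> tail_mass n \<mu> t"

lemma tail_mass_eq: "A i = measure \<mu> {d\<in>space \<mu>. i < reach n t d}"
  by (simp add: tail_mass_def space_\<mu>)

lemma measure_class: "measure \<mu> {d\<in>space \<mu>. reach n t d = Suc i} = A i - A (Suc i)"
proof -
  have "{d\<in>space \<mu>. reach n t d = Suc i} =
      {d\<in>space \<mu>. i < reach n t d} - {d\<in>space \<mu>. Suc i < reach n t d}"
    by auto
  also have "measure \<mu> \<dots> = A i - A (Suc i)"
    unfolding tail_mass_eq by (rule finite_measure_Diff) auto
  finally show ?thesis .
qed

sublocale masses A n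
proof
  show "antimono A"
    unfolding antimono_iff_le_Suc tail_mass_eq by (intro allI finite_measure_mono) auto
  have "{d\<in>space \<mu>. n < reach n t d} = {}"
    using reach_le[of n t] by (auto simp: not_less)
  then show "A n = 0"
    unfolding tail_mass_eq by (simp only: measure_empty)
qed

text \<open>Hence one oracle query yields each tail mass, also among tied levels.\<close>

lemma tail_mass_level_rank:
  assumes "j < n"
  shows "A (level_rank n t j) = measure \<mu> (interval_of True True (t j) 1 \<inter> types)"
proof -
  have "{d\<in>types. level_rank n t j < reach n t d} = interval_of True True (t j) 1 \<inter> types"
    using assms by (auto simp: level_rank_less_reach_iff interval_of_def)
  then show ?thesis by (simp add: tail_mass_def)
qed

lemma sum_class_strategy:
  "(\<Sum>j\<in>available n t d. class_strategy n \<mu> t (reach n t d) j) = 1"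
proof -
  let ?J = "{j. j < n \<and> t j \<le> d}" and ?c = "reach n t d"
  have "(\<Sum>j\<in>available n t d. class_strategy n \<mu> t ?c j) =
      of_bool (?c = 0) + (\<Sum>j\<in>Producer ` ?J. class_strategy n \<mu> t ?c j)"
    unfolding available_def
    by (subst sum.union_disjoint) (auto simp: class_strategy_NotConsuming)
  also have "(\<Sum>j\<in>Producer ` ?J. class_strategy n \<mu> t ?c j) =
      (\<Sum>j\<in>?J. if ?c = 0 then 0 else share A n (?c - 1) (level_rank n t j))"
    by (subst sum.reindex) (auto simp: inj_on_def class_strategy_Producer intro!: sum.cong)
  also have "\<dots> = (\<Sum>p<?c. if ?c = 0 then 0 else share A n (?c - 1) p)"
    unfolding level_rank_image_available[symmetric]
    by (subst sum.reindex) (auto intro: inj_on_subset[OF inj_on_level_rank])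
  also have "of_bool (?c = 0) + \<dots> = 1"
  proof (cases ?c)
    case (Suc i)
    with sum_share[of i] reach_le[of n t d] show ?thesis by (simp del: sum.lessThan_Suc)
  qed simp
  finally show ?thesis .
qed

lemma class_strategy_bounds:
  assumes "c \<le> n" "k \<in> strategies n"
  shows "class_strategy n \<mu> t c k \<in> {0..1}"
proof (cases k)
  case (Producer j)
  with assms have "j < n"
    by (auto simp: strategies_def)
  then show ?thesis
    using Producer assms share_nonneg share_le_1[of "c - 1" "level_rank n t j"] level_rank_less[of j n t]
    by (simp add: class_strategy_Producer)
qed (simp add: class_strategy_NotConsuming)

lemma chord_profile_mixed: "mixed_profile n \<mu> t (chord_profile n \<mu> t)"
  unfolding mixed_profile_def
proof (intro conjI ballI)
  let ?S = "(\<Pi>\<^sub>M j\<in>strategies n. restrict_space borel {0..1::real})"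
  have bounds: "class_strategy n \<mu> t c \<in> strategies n \<rightarrow>\<^sub>E {0..1}" if "c \<le> n" for c
    using class_strategy_bounds[OF that] by (auto simp: class_strategy_def)
  \<comment> \<open>Capping at \<open>n\<close> makes the map total on the naturals; the bounds are
    available only up to \<open>n\<close>.\<close>
  have "(\<lambda>d. class_strategy n \<mu> t (min n (reach n t d))) \<in> measurable (restrict_space borel types) ?S"
  proof (rule measurable_compose[OF measurable_reach_types])
    show "(\<lambda>c. class_strategy n \<mu> t (min n c)) \<in> count_space UNIV \<rightarrow>\<^sub>M ?S"
      using bounds by (auto simp: space_PiM space_restrict_space)
  qed
  then show "chord_profile n \<mu> t \<in> measurable (restrict_space borel types) ?S"
    unfolding chord_profile_def by (simp add: min_absorb2 reach_le)
  fix d :: real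
  have "class_strategy n \<mu> t (reach n t d) j = 0" if j: "j \<in> strategies n - available n t d" for j
  proof -
    obtain k where k: "j = Producer k" "k < n"
      using j by (cases j) (auto simp: strategies_def available_def)
    with j have "reach n t d \<le> level_rank n t k"
      using level_rank_less_reach_iff[of k n t d] by (auto simp: Producer_mem_available)
    with k show ?thesis
      using level_rank_less[of k n t] by (auto simp: class_strategy_Producer intro!: share_eq_0)
  qed
  then show "chord_profile n \<mu> t d \<in> mixed_strategies n (available n t d)"
    unfolding chord_profile_def mixed_strategies_def
    using bounds[OF reach_le] sum_class_strategy by auto
qed

text \<open>The profile is constant on each class, so its integral is a sum of shares times class
  masses, that is, of the overlaps in one column.\<close>

lemma load_chord_profile:
  assumes "j < n"
  shows "load \<mu> (chord_profile n \<mu> t) (Producer j) = rate A n (level_rank n t j) (D (level_rank n t j))"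
proof -
  let ?p = "level_rank n t j"
  have "chord_profile n \<mu> t d (Producer j) =
      (\<Sum>i<n. share A n i ?p * indicator {d\<in>space \<mu>. reach n t d = Suc i} d)"
    if "d \<in> space \<mu>" for d
  proof (cases "reach n t d")
    case (Suc i)
    then have "i < n"
      using reach_le[of n t d] by simp
    have "(\<Sum>i<n. share A n i ?p * indicator {d\<in>space \<mu>. reach n t d = Suc i} d) =
        (\<Sum>i'<n. if i' = i then share A n i ?p else 0)"
      using Suc that by (intro sum.cong) (auto simp: indicator_def)
    then show ?thesis
      using Suc \<open>i < n\<close> assms by (simp add: chord_profile_def class_strategy_Producer)
  qed (use assms in \<open>simp add: chord_profile_def class_strategy_Producer\<close>)
  then have "load \<mu> (chord_profile n \<mu> t) (Producer j) =
      (LINT d|\<mu>. (\<Sum>i<n. share A n i ?p * indicator {d\<in>space \<mu>. reach n t d = Suc i} d))"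
    unfolding load_def by (intro Bochner_Integration.integral_cong) auto
  also have "\<dots> = (\<Sum>i<n. share A n i ?p * measure \<mu> {d\<in>space \<mu>. reach n t d = Suc i})"
    by (subst Bochner_Integration.integral_sum) (auto simp: less_top[symmetric])
  also have "\<dots> = (\<Sum>i<n. overlap A n i ?p)"
    by (simp add: measure_class share_times_mass)
  finally show ?thesis
    using sum_overlap_column level_rank_less[OF assms] by simp
qed

lemma chord_profile_equilibrium: "mixed_Nash_equilibrium n \<mu> t (chord_profile n \<mu> t)"
  unfolding mixed_Nash_equilibrium_def
proof (intro conjI ballI impI)
  fix d assume "NotConsuming \<in> supp n (chord_profile n \<mu> t d)"
  then show "available n t d = {NotConsuming}"
    by (simp add: supp_def chord_profile_def class_strategy_NotConsuming reach_eq_0_iff split: if_splits)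
next
  fix d k j
  assume k: "k \<in> supp n (chord_profile n \<mu> t d)" and "j \<in> available n t d - {NotConsuming}"
  then obtain j' where j: "j = Producer j'" "j' < n" "t j' \<le> d"
    by (auto simp: available_def)
  then have r: "level_rank n t j' < reach n t d"
    by (simp add: level_rank_less_reach_iff)
  \<comment> \<open>As \<open>reach\<close> is positive, \<open>NotConsuming\<close> has weight
    \<open>0\<close>, so \<open>k\<close> must be a producer.\<close>
  then obtain k' where k': "k = Producer k'" "k' < n"
      and pos: "0 < share A n (reach n t d - 1) (level_rank n t k')"
    using k by (cases k) (auto simp: supp_def strategies_def chord_profile_def
      class_strategy_NotConsuming class_strategy_Producer)
  show "load \<mu> (chord_profile n \<mu> t) k \<le> load \<mu> (chord_profile n \<mu> t) j"
    using rate_minimal_if_share_pos[OF pos, of "level_rank n t j'"] r level_rank_less[OF k'(2), of t] reach_le[of n t d]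
    by (simp add: j k' load_chord_profile)
qed (rule chord_profile_mixed)

lemma chord_profile_symmetric: "symmetric_profile n t (chord_profile n \<mu> t)"
  unfolding symmetric_profile_def chord_profile_def by (metis reach_cong)

end

subsection \<open>Total correctness with time bounds\<close>

lemma idx_iupdate [simp]: "idx (iupdate x i v \<sigma>) = (idx \<sigma>)(x := (idx \<sigma> x)(i := v))"
  by (simp add: iupdate_def)

lemma rls_iupdate [simp]: "rls (iupdate x i v \<sigma>) = rls \<sigma>"
  by (simp add: iupdate_def)

lemma idx_rupdate [simp]: "idx (rupdate x i j v \<sigma>) = idx \<sigma>"
  by (simp add: rupdate_def)

lemma rls_rupdate [simp]:
  "rls (rupdate x i j v \<sigma>) = (rls \<sigma>)(x := (rls \<sigma> x)(i := (rls \<sigma> x i)(j := v)))"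
  by (simp add: rupdate_def)

text \<open>A bound on the running time provided that every loop makes at most \<open>n\<close> iterations.\<close>

primrec time_bound :: "nat \<Rightarrow> com \<Rightarrow> nat" where
  "time_bound n Skip = 1"
| "time_bound n (IAssign x e1 e2) = itime e1 + itime e2 + 1"
| "time_bound n (RAssign x e1 e2 e) = itime e1 + itime e2 + rtime e + 1"
| "time_bound n (Seq c1 c2) = time_bound n c1 + time_bound n c2"
| "time_bound n (Cond b c1 c2) = btime b + 1 + (time_bound n c1 + time_bound n c2)"
| "time_bound n (Loop b c) = n * (btime b + 1 + time_bound n c) + (btime b + 1)"

text \<open>Total correctness in weakest-precondition style: postconditions nest along
  \<open>Seq\<close>, and the time bound depends only on the program and \<open>n\<close>.\<close>

definition exec :: "real measure \<Rightarrow> nat \<Rightarrow> com \<Rightarrow> memory \<Rightarrow> (memory \<Rightarrow> bool) \<Rightarrow> bool"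
  where "exec \<mu> n c \<sigma> Q \<longleftrightarrow> (\<exists>k \<sigma>'. runs \<mu> c \<sigma> k \<sigma>' \<and> k \<le> time_bound n c \<and> Q \<sigma>')"

lemma exec_Skip: "Q \<sigma> \<Longrightarrow> exec \<mu> n Skip \<sigma> Q"
  unfolding exec_def by (auto intro!: exI runs.Skip)

lemma exec_IAssign:
  "Q (iupdate x (ival \<sigma> e1) (ival \<sigma> e2) \<sigma>) \<Longrightarrow> exec \<mu> n (IAssign x e1 e2) \<sigma> Q"
  unfolding exec_def by (intro exI conjI, rule runs.IAssign) auto

lemma exec_RAssign:
  "Q (rupdate x (ival \<sigma> e1) (ival \<sigma> e2) (rval \<mu> \<sigma> e) \<sigma>) \<Longrightarrow> exec \<mu> n (RAssign x e1 e2 e) \<sigma> Q"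
  unfolding exec_def by (intro exI conjI, rule runs.RAssign) auto

lemma exec_Seq:
  "exec \<mu> n c1 \<sigma> (\<lambda>\<sigma>'. exec \<mu> n c2 \<sigma>' Q) \<Longrightarrow> exec \<mu> n (Seq c1 c2) \<sigma> Q"
  unfolding exec_def by (fastforce intro: runs.Seq add_mono)

lemma exec_Cond:
  assumes "bval \<mu> \<sigma> b \<Longrightarrow> exec \<mu> n c1 \<sigma> Q" "\<not> bval \<mu> \<sigma> b \<Longrightarrow> exec \<mu> n c2 \<sigma> Q"
  shows "exec \<mu> n (Cond b c1 c2) \<sigma> Q"
proof (cases "bval \<mu> \<sigma> b")
  case True
  from assms(1)[OF this] obtain k \<sigma>' where "runs \<mu> c1 \<sigma> k \<sigma>'" "k \<le> time_bound n c1" "Q \<sigma>'"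
    unfolding exec_def by blast
  then show ?thesis
    unfolding exec_def using runs.CondTrue[OF True] by (intro exI[of _ "btime b + 1 + k"] exI[of _ \<sigma>']) auto
next
  case False
  from assms(2)[OF this] obtain k \<sigma>' where "runs \<mu> c2 \<sigma> k \<sigma>'" "k \<le> time_bound n c2" "Q \<sigma>'"
    unfolding exec_def by blast
  then show ?thesis
    unfolding exec_def using runs.CondFalse[OF False] by (intro exI[of _ "btime b + 1 + k"] exI[of _ \<sigma>']) auto
qed

lemma exec_mono: "exec \<mu> n c \<sigma> P \<Longrightarrow> (\<And>\<sigma>'. P \<sigma>' \<Longrightarrow> Q \<sigma>') \<Longrightarrow> exec \<mu> n c \<sigma> Q"
  unfolding exec_def by blast

text \<open>Induction on the number \<open>m - i\<close> of remaining iterations. Indexing the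
  invariant by the iterations done fixes the exact count.\<close>

lemma runs_Loop:
  assumes body: "\<And>i \<sigma>. i < m \<Longrightarrow> I i \<sigma> \<Longrightarrow> bval \<mu> \<sigma> b \<and> exec \<mu> n c \<sigma> (I (Suc i))"
    and exit: "\<And>\<sigma>. I m \<sigma> \<Longrightarrow> \<not> bval \<mu> \<sigma> b"
    and "i \<le> m" "I i \<sigma>"
  shows "\<exists>k \<sigma>'. runs \<mu> (Loop b c) \<sigma> k \<sigma>' \<and>
    k \<le> (m - i) * (btime b + 1 + time_bound n c) + (btime b + 1) \<and> I m \<sigma>'"
  using assms(3,4)
proof (induction "m - i" arbitrary: i \<sigma>)
  case 0
  then have "I m \<sigma>" by simp
  then show ?case
    using runs.LoopFalse[OF exit] by fastforce
next
  case (Suc d)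
  then have i: "i < m" by simp
  with body Suc.prems have b: "bval \<mu> \<sigma> b" and "exec \<mu> n c \<sigma> (I (Suc i))"
    by blast+
  then obtain k1 \<sigma>1 where 1: "runs \<mu> c \<sigma> k1 \<sigma>1" "k1 \<le> time_bound n c" "I (Suc i) \<sigma>1"
    unfolding exec_def by blast
  have "d = m - Suc i" "Suc i \<le> m"
    using Suc.hyps(2) i by simp_all
  from Suc.hyps(1)[OF this 1(3)] obtain k2 \<sigma>2 where 2:
      "runs \<mu> (Loop b c) \<sigma>1 k2 \<sigma>2"
      "k2 \<le> (m - Suc i) * (btime b + 1 + time_bound n c) + (btime b + 1)" "I m \<sigma>2"
    using \<open>d = m - Suc i\<close> by blast
  have "m - i = Suc (m - Suc i)"
    using i by simp
  then have "btime b + 1 + k1 + k2 \<le> (m - i) * (btime b + 1 + time_bound n c) + (btime b + 1)"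
    using 1(2) 2(2) by simp
  then show ?case
    using runs.LoopTrue[OF b 1(1) 2(1)] 2(3) by blast
qed

lemma exec_Loop:
  assumes "I 0 \<sigma>" "m \<le> n"
    and "\<And>i \<sigma>. i < m \<Longrightarrow> I i \<sigma> \<Longrightarrow> bval \<mu> \<sigma> b \<and> exec \<mu> n c \<sigma> (I (Suc i))"
    and "\<And>\<sigma>. I m \<sigma> \<Longrightarrow> \<not> bval \<mu> \<sigma> b \<and> Q \<sigma>"
  shows "exec \<mu> n (Loop b c) \<sigma> Q"
proof -
  have "\<exists>k \<sigma>'. runs \<mu> (Loop b c) \<sigma> k \<sigma>' \<and>
      k \<le> (m - 0) * (btime b + 1 + time_bound n c) + (btime b + 1) \<and> I m \<sigma>'"
    by (rule runs_Loop) (use assms in auto)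
  moreover have "(m - 0) * (btime b + 1 + time_bound n c) \<le> n * (btime b + 1 + time_bound n c)"
    using assms(2) by (simp only: diff_zero mult_le_mono1)
  ultimately show ?thesis
    unfolding exec_def using assms(4) by fastforce
qed

lemmas exec_intros = exec_Seq exec_IAssign exec_RAssign exec_Cond exec_Skip

abbreviation ivar :: "string \<Rightarrow> iexp"
  where "ivar x \<equiv> ICell x (INum 0)"

abbreviation rvar :: "string \<Rightarrow> rexp"
  where "rvar x \<equiv> RCell x (INum 0) (INum 0)"

abbreviation entry :: "string \<Rightarrow> iexp \<Rightarrow> rexp"
  where "entry x e \<equiv> RCell x e (INum 0)"

abbreviation increment :: "string \<Rightarrow> iexp \<Rightarrow> com"
  where "increment x e \<equiv> IAssign x e (IAdd (ICell x e) (INum 1))"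

subsection \<open>The program\<close>

text \<open>Strict comparisons split the levels three ways. At equal levels \<open>j\<close> is
  always within reach of \<open>t i\<close> but precedes \<open>i\<close> only if its index is
  smaller.\<close>

definition count_step :: com
  where "count_step =
    Seq
      (Cond (BRLess (entry ''t'' (ivar ''j'')) (entry ''t'' (ivar ''i'')))
        (Seq (increment ''rank'' (ivar ''i'')) (increment ''reach'' (ivar ''i'')))
        (Cond (BRLess (entry ''t'' (ivar ''i'')) (entry ''t'' (ivar ''j'')))
          Skip
          (Seq (increment ''reach'' (ivar ''i''))
            (Cond (BILess (ivar ''j'') (ivar ''i'')) (increment ''rank'' (ivar ''i'')) Skip))))
      (increment ''j'' (INum 0))"

text \<open>The ranks exhaust the indices below \<open>n\<close>; cell \<open>n\<close> of
  \<open>A\<close> keeps its initial \<open>0\<close>, the correct tail mass.\<close>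

definition rank_program :: com
  where "rank_program =
    Loop (BILess (ivar ''i'') (ivar ''n''))
      (Seq (IAssign ''j'' (INum 0) (INum 0))
      (Seq (Loop (BILess (ivar ''j'') (ivar ''n'')) count_step)
      (Seq (RAssign ''A'' (ICell ''rank'' (ivar ''i'')) (INum 0)
             (RMeasure True True (entry ''t'' (ivar ''i'')) (RNum 1)))
           (increment ''i'' (INum 0)))))"

text \<open>\<open>width\<close> carries \<open>b - a\<close> as a real number, since indices cannot
  be converted to reals.\<close>

definition chord_step :: com
  where "chord_step =
    Seq
      (Cond (BRLess (rvar ''best'')
          (RDiv (RSub (entry ''D'' (ivar ''a'')) (entry ''A'' (ivar ''b''))) (rvar ''width'')))
        (RAssign ''best'' (INum 0) (INum 0)
          (RDiv (RSub (entry ''D'' (ivar ''a'')) (entry ''A'' (ivar ''b''))) (rvar ''width'')))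
        Skip)
      (Seq (RAssign ''width'' (INum 0) (INum 0) (RAdd (rvar ''width'') (RNum 1)))
           (increment ''b'' (INum 0)))"

definition residual_program :: com
  where "residual_program =
    Seq (RAssign ''D'' (INum 0) (INum 0) (entry ''A'' (INum 0)))
      (Loop (BILess (ivar ''a'') (ivar ''n''))
        (Seq (IAssign ''b'' (INum 0) (IAdd (ivar ''a'') (INum 1)))
        (Seq (RAssign ''width'' (INum 0) (INum 0) (RNum 1))
        (Seq (RAssign ''best'' (INum 0) (INum 0) (RNum 0))
        (Seq (Loop (BILess (ivar ''b'') (IAdd (ivar ''n'') (INum 1))) chord_step)
        (Seq (RAssign ''D'' (IAdd (ivar ''a'') (INum 1)) (INum 0)
               (RSub (entry ''D'' (ivar ''a'')) (rvar ''best'')))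
             (increment ''a'' (INum 0))))))))"

text \<open>Rows and columns keep the original numbering of the producers; ranks enter only as
  lookups. Entries with share zero are left at their initial value.\<close>

definition share_step :: com
  where "share_step =
    (let c = ICell ''reach'' (ivar ''k''); i = ISub c (INum 1); p = ICell ''rank'' (ivar ''l'')
     in
      Seq (RAssign ''hi'' (INum 0) (INum 0) (entry ''A'' i))
      (Seq (Cond (BRLess (entry ''D'' p) (rvar ''hi''))
             (RAssign ''hi'' (INum 0) (INum 0) (entry ''D'' p)) Skip)
      (Seq (RAssign ''lo'' (INum 0) (INum 0) (entry ''A'' c))
      (Seq (Cond (BRLess (rvar ''lo'') (entry ''D'' (IAdd p (INum 1))))
             (RAssign ''lo'' (INum 0) (INum 0) (entry ''D'' (IAdd p (INum 1)))) Skip)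
      (Seq (Cond (BRLess (rvar ''lo'') (rvar ''hi''))
             (RAssign ''s'' (ivar ''k'') (ivar ''l'')
               (RDiv (RSub (rvar ''hi'') (rvar ''lo'')) (RSub (entry ''A'' i) (entry ''A'' c))))
             (Cond (BAnd (BNot (BRLess (entry ''A'' c) (entry ''A'' i)))
                     (BAnd (BNot (BILess p i)) (BNot (BILess i p))))
               (RAssign ''s'' (ivar ''k'') (ivar ''l'') (RNum 1))
               Skip))
           (increment ''l'' (INum 0)))))))"

text \<open>The last assignment serves the types below all levels: row \<open>n\<close> is their
  class, column \<open>n\<close> is \<open>NotConsuming\<close>.\<close>

definition output_program :: com
  where "output_program =
    Seq
      (Loop (BILess (ivar ''k'') (ivar ''n''))
        (Seq (IAssign ''l'' (INum 0) (INum 0))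
        (Seq (Loop (BILess (ivar ''l'') (ivar ''n'')) share_step)
             (increment ''k'' (INum 0)))))
      (RAssign ''s'' (ivar ''n'') (ivar ''n'') (RNum 1))"

definition equilibrium_program :: com
  where "equilibrium_program = Seq rank_program (Seq residual_program output_program)"

section \<open>Correctness of the ranks and tail masses\<close>

lemma card_less_Suc_conj:
  "card {l. l < Suc j \<and> P l} = card {l. l < j \<and> P l} + of_bool (P j)"
proof (cases "P j")
  case True
  then have "{l. l < Suc j \<and> P l} = insert j {l. l < j \<and> P l}"
    by auto
  with True show ?thesis by simp
next
  case False
  then have "{l. l < Suc j \<and> P l} = {l. l < j \<and> P l}"
    by (auto simp: less_Suc_eq)
  with False show ?thesis by simp
qed

text \<open>\<open>r\<close> and \<open>c\<close> are the partial counts for producer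
  \<open>i\<close>; with both \<open>0\<close> this is the state between two rounds of the outer
  loop.\<close>

definition counting :: "nat \<Rightarrow> (nat \<Rightarrow> real) \<Rightarrow> nat \<Rightarrow> nat \<Rightarrow> nat \<Rightarrow> memory \<Rightarrow> bool"
  where "counting n t i r c \<sigma> \<longleftrightarrow>
    idx \<sigma> ''n'' 0 = n \<and> idx \<sigma> ''a'' 0 = 0 \<and> idx \<sigma> ''k'' 0 = 0 \<and> idx \<sigma> ''i'' 0 = i \<and>
    (\<forall>k. idx \<sigma> ''rank'' k = (if k < i then level_rank n t k else if k = i then r else 0)) \<and>
    (\<forall>k. idx \<sigma> ''reach'' k = (if k < i then reach n t (t k) else if k = i then c else 0)) \<and>
    (\<forall>k<n. rls \<sigma> ''t'' k 0 = t k) \<and> (\<forall>k l. rls \<sigma> ''s'' k l = 0)"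

text \<open>The later phases start from the zero counters and the blank array \<open>s\<close>
  without initialising them.\<close>

definition prepared :: "nat \<Rightarrow> real measure \<Rightarrow> (nat \<Rightarrow> real) \<Rightarrow> memory \<Rightarrow> bool"
  where "prepared n \<mu> t \<sigma> \<longleftrightarrow>
    idx \<sigma> ''n'' 0 = n \<and> idx \<sigma> ''a'' 0 = 0 \<and> idx \<sigma> ''k'' 0 = 0 \<and>
    (\<forall>k<n. idx \<sigma> ''rank'' k = level_rank n t k \<and> idx \<sigma> ''reach'' k = reach n t (t k)) \<and>
    (\<forall>p\<le>n. rls \<sigma> ''A'' p 0 = tail_mass n \<mu> t p) \<and> (\<forall>k l. rls \<sigma> ''s'' k l = 0)"

lemma exec_count_step:
  assumes "counting n t i (card {l. l < j \<and> precedes t l i}) (card {l. l < j \<and> t l \<le> t i}) \<sigma>"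
    and "idx \<sigma> ''j'' 0 = j" "rls \<sigma> ''A'' = F" "i < n" "j < n"
  shows "exec \<mu> n count_step \<sigma> (\<lambda>\<sigma>.
    counting n t i (card {l. l < Suc j \<and> precedes t l i}) (card {l. l < Suc j \<and> t l \<le> t i}) \<sigma> \<and>
    idx \<sigma> ''j'' 0 = Suc j \<and> rls \<sigma> ''A'' = F)"
  unfolding count_step_def card_less_Suc_conj
  using assms
  by (intro exec_intros) (auto simp: counting_def precedes_def)

context game
begin

lemma exec_rank_program: "exec \<mu> n rank_program (input_memory n t) (prepared n \<mu> t)"
proof -
  define I where "I i \<sigma> \<longleftrightarrow> counting n t i 0 0 \<sigma> \<and>
    (\<forall>p. rls \<sigma> ''A'' p 0 = (if p \<in> level_rank n t ` {..<i} then A p else 0))" for i \<sigma>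
  show ?thesis
    unfolding rank_program_def
  proof (rule exec_Loop[where I = I and m = n])
    show "I 0 (input_memory n t)"
      by (simp add: I_def counting_def input_memory_def)
  next
    fix \<sigma> assume I: "I n \<sigma>"
    have "rls \<sigma> ''A'' p 0 = A p" if "p \<le> n" for p
      using I bij_betw_level_rank[of n t] that A_n by (auto simp: I_def bij_betw_def)
    with I show "\<not> bval \<mu> \<sigma> (BILess (ivar ''i'') (ivar ''n'')) \<and> prepared n \<mu> t \<sigma>"
      by (simp add: I_def counting_def prepared_def)
  next
    fix i \<sigma> assume i: "i < n" and I: "I i \<sigma>"
    define J where "J j \<sigma>' \<longleftrightarrow>
      counting n t i (card {l. l < j \<and> precedes t l i}) (card {l. l < j \<and> t l \<le> t i}) \<sigma>' \<and>
      idx \<sigma>' ''j'' 0 = j \<and> rls \<sigma>' ''A'' = rls \<sigma> ''A''" for j \<sigma>'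
    show "bval \<mu> \<sigma> (BILess (ivar ''i'') (ivar ''n'')) \<and>
      exec \<mu> n (Seq (IAssign ''j'' (INum 0) (INum 0))
        (Seq (Loop (BILess (ivar ''j'') (ivar ''n'')) count_step)
        (Seq (RAssign ''A'' (ICell ''rank'' (ivar ''i'')) (INum 0)
               (RMeasure True True (entry ''t'' (ivar ''i'')) (RNum 1)))
             (increment ''i'' (INum 0))))) \<sigma> (I (Suc i))"
    proof (intro conjI exec_Seq exec_IAssign exec_Loop[where I = J and m = n])
      show "bval \<mu> \<sigma> (BILess (ivar ''i'') (ivar ''n''))"
        using I i by (simp add: I_def counting_def)
      show "J 0 (iupdate ''j'' (ival \<sigma> (INum 0)) (ival \<sigma> (INum 0)) \<sigma>)"
        using I by (simp add: I_def J_def counting_def)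
    next
      fix j \<sigma>' assume "j < n" "J j \<sigma>'"
      then show "bval \<mu> \<sigma>' (BILess (ivar ''j'') (ivar ''n''))"
          and "exec \<mu> n count_step \<sigma>' (J (Suc j))"
        using exec_count_step[of n t i j \<sigma>' "rls \<sigma> ''A''" \<mu>] i unfolding J_def
        by (simp_all add: counting_def)
    next
      fix \<sigma>' assume J: "J n \<sigma>'"
      then show "\<not> bval \<mu> \<sigma>' (BILess (ivar ''j'') (ivar ''n''))"
        by (simp add: J_def counting_def)
      have J': "counting n t i (level_rank n t i) (reach n t (t i)) \<sigma>'" "rls \<sigma>' ''A'' = rls \<sigma> ''A''"
        using J by (simp_all add: J_def level_rank_def reach_def)
      show "exec \<mu> n (RAssign ''A'' (ICell ''rank'' (ivar ''i'')) (INum 0)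
          (RMeasure True True (entry ''t'' (ivar ''i'')) (RNum 1))) \<sigma>'
          (\<lambda>\<sigma>. exec \<mu> n (increment ''i'' (INum 0)) \<sigma> (I (Suc i)))"
        using I J' i tail_mass_level_rank[OF i]
        by (intro exec_intros) (auto simp: I_def counting_def less_Suc_eq lessThan_Suc)
    qed simp
  qed simp
qed

section \<open>Correctness of the slopes\<close>

definition residuals_upto :: "nat \<Rightarrow> memory \<Rightarrow> bool"
  where "residuals_upto a \<sigma> \<longleftrightarrow>
    idx \<sigma> ''n'' 0 = n \<and> idx \<sigma> ''a'' 0 = a \<and> idx \<sigma> ''k'' 0 = 0 \<and>
    (\<forall>k<n. idx \<sigma> ''rank'' k = level_rank n t k \<and> idx \<sigma> ''reach'' k = reach n t (t k)) \<and>
    (\<forall>p\<le>n. rls \<sigma> ''A'' p 0 = A p) \<and> (\<forall>p\<le>a. rls \<sigma> ''D'' p 0 = D p) \<and>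
    (\<forall>k l. rls \<sigma> ''s'' k l = 0)"

text \<open>The running maximum before chord \<open>b\<close> is tried: \<open>0\<close> at
  \<open>b = Suc a\<close>, the full \<open>rate\<close> at \<open>b = Suc n\<close>.\<close>

definition best_chord :: "nat \<Rightarrow> nat \<Rightarrow> real"
  where "best_chord a b = Max (insert 0 ((\<lambda>b. (D a - A b) / real (b - a)) ` {Suc a..<b}))"

lemma best_chord_Suc:
  assumes "a < b"
  shows "best_chord a (Suc b) = max (best_chord a b) ((D a - A b) / real (b - a))"
proof -
  have "{Suc a..<Suc b} = insert b {Suc a..<b}"
    using assms by auto
  then show ?thesis
    unfolding best_chord_def by (simp add: insert_commute[of 0] max.commute del: of_nat_diff)
qed

lemma exec_residual_program:
  assumes "prepared n \<mu> t \<sigma>"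
  shows "exec \<mu> n residual_program \<sigma> (residuals_upto n)"
  unfolding residual_program_def
proof (intro exec_Seq exec_RAssign, rule exec_Loop[where I = residuals_upto and m = n])
  show "residuals_upto 0 (rupdate ''D'' (ival \<sigma> (INum 0)) (ival \<sigma> (INum 0)) (rval \<mu> \<sigma> (entry ''A'' (INum 0))) \<sigma>)"
    using assms by (simp add: prepared_def residuals_upto_def)
next
  fix \<sigma> assume "residuals_upto n \<sigma>"
  then show "\<not> bval \<mu> \<sigma> (BILess (ivar ''a'') (ivar ''n'')) \<and> residuals_upto n \<sigma>"
    by (simp add: residuals_upto_def)
next
  fix a \<sigma> assume a: "a < n" and I: "residuals_upto a \<sigma>"
  define J where "J m \<sigma> \<longleftrightarrow> residuals_upto a \<sigma> \<and> idx \<sigma> ''b'' 0 = Suc a + m \<and>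
    rls \<sigma> ''width'' 0 0 = real (Suc m) \<and> rls \<sigma> ''best'' 0 0 = best_chord a (Suc a + m)" for m \<sigma>
  show "bval \<mu> \<sigma> (BILess (ivar ''a'') (ivar ''n'')) \<and>
    exec \<mu> n (Seq (IAssign ''b'' (INum 0) (IAdd (ivar ''a'') (INum 1)))
        (Seq (RAssign ''width'' (INum 0) (INum 0) (RNum 1))
        (Seq (RAssign ''best'' (INum 0) (INum 0) (RNum 0))
        (Seq (Loop (BILess (ivar ''b'') (IAdd (ivar ''n'') (INum 1))) chord_step)
        (Seq (RAssign ''D'' (IAdd (ivar ''a'') (INum 1)) (INum 0)
               (RSub (entry ''D'' (ivar ''a'')) (rvar ''best'')))
             (increment ''a'' (INum 0))))))) \<sigma> (residuals_upto (Suc a))"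
  proof (rule conjI, goal_cases)
    case 1
    show ?case
      using I a by (simp add: residuals_upto_def)
  next
    case 2
    show ?case
    proof (intro exec_Seq exec_IAssign exec_RAssign, rule exec_Loop[where I = J and m = "n - a"], goal_cases)
      case 1
      show ?case
        using I by (simp add: J_def residuals_upto_def best_chord_def)
    next
      case (3 m \<sigma>)
      have "best_chord a (Suc (Suc a + m)) = max (best_chord a (Suc a + m)) ((D a - A (Suc a + m)) / real (Suc m))"
        using best_chord_Suc[of a "Suc a + m"] by simp
      then have "exec \<mu> n chord_step \<sigma> (J (Suc m))"
        unfolding chord_step_def using 3 a
        by (intro exec_intros) (auto simp: J_def residuals_upto_def max_def)
      then show ?case
        using 3 a by (auto simp: J_def residuals_upto_def)
    next
      case (4 \<sigma>)
      have "best_chord a (Suc n) = rate A n a (D a)"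
        by (simp add: best_chord_def rate_def atLeastLessThanSuc_atLeastAtMost)
      with 4 a show ?case
        by (intro conjI exec_intros) (auto simp: J_def residuals_upto_def le_Suc_eq)
    qed (use a in simp)
  qed
qed simp

section \<open>Correctness of the shares and the running time\<close>

definition written :: "nat \<Rightarrow> nat \<Rightarrow> memory \<Rightarrow> bool"
  where "written i j \<sigma> \<longleftrightarrow>
    idx \<sigma> ''n'' 0 = n \<and> idx \<sigma> ''k'' 0 = i \<and>
    (\<forall>k<n. idx \<sigma> ''rank'' k = level_rank n t k \<and> idx \<sigma> ''reach'' k = reach n t (t k)) \<and>
    (\<forall>p\<le>n. rls \<sigma> ''A'' p 0 = A p) \<and> (\<forall>p\<le>n. rls \<sigma> ''D'' p 0 = D p) \<and>
    (\<forall>k l. rls \<sigma> ''s'' k l =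
      (if l < n \<and> (k < i \<or> k = i \<and> l < j)
       then share A n (reach n t (t k) - 1) (level_rank n t l) else 0))"

lemma exec_share_step:
  assumes "written i j \<sigma>" "idx \<sigma> ''l'' 0 = j" "i < n" "j < n"
  shows "exec \<mu> n share_step \<sigma> (\<lambda>\<sigma>. written i (Suc j) \<sigma> \<and> idx \<sigma> ''l'' 0 = Suc j)"
proof -
  \<comment> \<open>The type \<open>t i\<close> reaches at least producer \<open>i\<close>, so the
    truncated subtraction in the program is exact.\<close>
  obtain c where c: "reach n t (t i) = Suc c" "c < n"
    using level_rank_less_reach_iff[of i n t "t i"] reach_le[of n t "t i"] assms(3)
    by (cases "reach n t (t i)") auto
  define p where "p = level_rank n t j"
  have p: "p < n"
    using level_rank_less[OF assms(4)] by (simp add: p_def)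
  have cells: "rls \<sigma> ''A'' c 0 = A c" "rls \<sigma> ''A'' (Suc c) 0 = A (Suc c)"
      "rls \<sigma> ''D'' p 0 = D p" "rls \<sigma> ''D'' (Suc p) 0 = D (Suc p)"
      "idx \<sigma> ''rank'' j = p" "idx \<sigma> ''reach'' i = Suc c" "idx \<sigma> ''k'' 0 = i" "rls \<sigma> ''s'' i j = 0"
    using assms(1,3,4) c p by (auto simp: written_def p_def)
  have step: "written i (Suc j) \<sigma>'"
    if "idx \<sigma>' = (idx \<sigma>)(''l'' := (idx \<sigma> ''l'')(0 := Suc j))"
      and "rls \<sigma>' ''A'' = rls \<sigma> ''A''" "rls \<sigma>' ''D'' = rls \<sigma> ''D''"
      and "rls \<sigma>' ''s'' = (rls \<sigma> ''s'')(i := (rls \<sigma> ''s'' i)(j := share A n c p))" for \<sigma>'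
    using assms(1,4) that c(1) by (auto simp: written_def p_def less_Suc_eq)
  \<comment> \<open>This follows the branches of the program. The case \<open>lo < hi\<close> forces
    \<open>A (Suc c) < A c\<close>, so the divisor is positive.\<close>
  have share: "share A n c p =
      (let hi = min (A c) (D p); lo = max (A (Suc c)) (D (Suc p)) in
       if lo < hi then (hi - lo) / (A c - A (Suc c))
       else if \<not> A (Suc c) < A c \<and> p = c then 1 else 0)"
    by (auto simp: share_def overlap_def Let_def simp del: residual.simps)
  show ?thesis
    unfolding share_step_def Let_def
    by (intro exec_intros conjI step)
      (auto simp: cells assms(2) share min_def max_def Let_def fun_eq_iff
        simp del: residual.simps split: if_splits)
qed

lemma exec_output_program:
  assumes "residuals_upto n \<sigma>"
  shows "exec \<mu> n output_program \<sigma> (\<lambda>\<sigma>. \<forall>k l. rls \<sigma> ''s'' k l =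
      (if k < n \<and> l < n then share A n (reach n t (t k) - 1) (level_rank n t l)
       else of_bool (k = n \<and> l = n)))"
  unfolding output_program_def
proof (rule exec_Seq, rule exec_Loop[where I = "\<lambda>i. written i 0" and m = n])
  show "written 0 0 \<sigma>"
    using assms by (simp add: residuals_upto_def written_def del: residual.simps)
next
  fix i \<sigma> assume i: "i < n" and I: "written i 0 \<sigma>"
  show "bval \<mu> \<sigma> (BILess (ivar ''k'') (ivar ''n'')) \<and>
    exec \<mu> n (Seq (IAssign ''l'' (INum 0) (INum 0))
        (Seq (Loop (BILess (ivar ''l'') (ivar ''n'')) share_step)
             (increment ''k'' (INum 0)))) \<sigma> (written (Suc i) 0)"
  proof (intro conjI exec_Seq exec_IAssign
      exec_Loop[where I = "\<lambda>j \<sigma>. written i j \<sigma> \<and> idx \<sigma> ''l'' 0 = j" and m = n], goal_cases)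
    case (6 j \<sigma>)
    then show ?case
      using exec_share_step i by blast
  next
    case (8 \<sigma>)
    then show ?case
      by (auto simp: written_def less_Suc_eq)
  qed (use i I in \<open>auto simp: written_def\<close>)
qed (auto simp: written_def intro!: exec_RAssign)

lemma exec_equilibrium_program:
  "exec \<mu> n equilibrium_program (input_memory n t)
    (\<lambda>\<sigma>. output_represents n t \<sigma> (chord_profile n \<mu> t))"
  unfolding equilibrium_program_def
proof (intro exec_Seq exec_mono[OF exec_rank_program] exec_mono[OF exec_residual_program]
    exec_mono[OF exec_output_program])
  fix \<sigma> :: memory assume s: "\<forall>k l. rls \<sigma> ''s'' k l =
      (if k < n \<and> l < n then share A n (reach n t (t k) - 1) (level_rank n t l)
       else of_bool (k = n \<and> l = n))"
  have "rls \<sigma> ''s'' k (column n j) = chord_profile n \<mu> t d j"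
    if "j \<in> strategies n" "k < n" "available n t d = available n t (t k)" for d j k
  proof -
    \<comment> \<open>Positive reach gives \<open>NotConsuming\<close> weight \<open>0\<close>,
      matching column \<open>n\<close>, which is zero in all rows below \<open>n\<close>.\<close>
    have "reach n t d = reach n t (t k)" "0 < reach n t (t k)"
      using reach_cong[OF that(3)] level_rank_less_reach_iff[OF that(2), of t "t k"] by auto
    then show ?thesis
      using that s by (auto simp: chord_profile_def strategies_def class_strategy_Producer
        class_strategy_NotConsuming)
  qed
  moreover have "rls \<sigma> ''s'' n (column n j) = chord_profile n \<mu> t d j"
    if "j \<in> strategies n" "available n t d = {NotConsuming}" for d j
    using that s by (auto simp: chord_profile_def strategies_def class_strategy_Producer
        class_strategy_NotConsuming reach_eq_0_iff[symmetric])
  ultimately show "output_represents n t \<sigma> (chord_profile n \<mu> t)"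
    unfolding output_represents_def by blast
qed

end

lemmas program_defs = equilibrium_program_def rank_program_def residual_program_def
  output_program_def count_step_def chord_step_def share_step_def

text \<open>Loops nest to depth two, so \<open>time_bound\<close> of this fixed program is a
  quadratic polynomial in \<open>n\<close>.\<close>

lemma time_bound_equilibrium_program:
  "(\<lambda>n. real (time_bound n equilibrium_program)) \<in> O(\<lambda>n. real n ^ 2)"
  unfolding program_defs Let_def
  by simp real_asymp

theorem theorem3p10:
  shows "(\<forall>(n::nat) (\<mu>::real measure) (t::nat \<Rightarrow> real). consumer_game n \<mu> t \<longrightarrow>
            (\<exists>s. mixed_Nash_equilibrium n \<mu> t s \<and> symmetric_profile n t s)) \<and>
         (\<exists>(prog::com) (T::nat \<Rightarrow> real). T \<in> O(\<lambda>n. real n ^ 2) \<and>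
            (\<forall>(n::nat) (\<mu>::real measure) (t::nat \<Rightarrow> real). consumer_game n \<mu> t \<longrightarrow>
              (\<exists>s k \<sigma>. mixed_Nash_equilibrium n \<mu> t s \<and> symmetric_profile n t s \<and>
                 runs \<mu> prog (input_memory n t) k \<sigma> \<and> real k \<le> T n \<and>
                 output_represents n t \<sigma> s)))"
proof (intro conjI allI impI exI[of _ equilibrium_program]
    exI[of _ "\<lambda>n. real (time_bound n equilibrium_program)"])
  fix n \<mu> t assume "consumer_game n \<mu> t"
  then interpret game n \<mu> t
    by unfold_locales
  show "\<exists>s. mixed_Nash_equilibrium n \<mu> t s \<and> symmetric_profile n t s"
    using chord_profile_equilibrium chord_profile_symmetric by blast
  show "\<exists>s k \<sigma>. mixed_Nash_equilibrium n \<mu> t s \<and> symmetric_profile n t s \<and>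
      runs \<mu> equilibrium_program (input_memory n t) k \<sigma> \<and>
      real k \<le> real (time_bound n equilibrium_program) \<and> output_represents n t \<sigma> s"
    using exec_equilibrium_program chord_profile_equilibrium chord_profile_symmetric
    unfolding exec_def of_nat_le_iff by blast
qed (rule time_bound_equilibrium_program)

end
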